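(* Let $m$ be a positive integer of the form $m=5\ell-1+c(6\ell-1)$ with $\ell$ a positive integer and $c\in\mathbb N$. Then $$\frac{4}{24m+1}=\frac{1}{6m+1}+\frac{1}{2\ell(6c+5)(24m+1)}+\frac{1}{2\ell(6c+5)(6\ell-1)(24m+1)},$$ and the corresponding triple $(n_1,n_2,n_3)=\bigl(6m+1,\;2\ell(6c+5)(24m+1),\;2\ell(6c+5)(6\ell-1)(24m+1)\bigr)$ is a wild solution of the Erdős–Straus equation for $24m+1$.
   Context: $\mathbb N$ denotes the set of nonnegative integers. For a positive integer $m$, the Erdős–Straus equation for $n=24m+1$ is $\frac{4}{n}=\frac1{n_1}+\frac1{n_2}+\frac1{n_3}$ in positive integers $n_1,n_2,n_3$. For $n_1=6m+k$ with $1\le k\le 12m$ one has $\frac{4}{24m+1}=\frac{1}{6m+k}+\frac{4k-1}{(6m+k)(24m+1)}$. A solution $(n_1,n_2,n_3)$ is called a wild solution if $n_1=6m+k$ for some integer $1\le k\le 12m$ and there exist an integer $L\ge 2$ (called a multiplier) and positive integers $J_1,J_2$ (called the numerator summands) such that $J_1+J_2=L(4k-1)$, $\gcd(L,J_1,J_2)=1$, $\frac1{n_2}=\frac{J_1}{L(6m+k)(24m+1)}$ and $\frac1{n_3}=\frac{J_2}{L(6m+k)(24m+1)}$. *)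

theory Defs
  imports Complex_Main
begin

definition erdos_straus_solution :: "nat \<Rightarrow> nat \<Rightarrow> nat \<Rightarrow> nat \<Rightarrow> bool" where
  "erdos_straus_solution n n1 n2 n3 \<longleftrightarrow>
     n1 > 0 \<and> n2 > 0 \<and> n3 > 0 \<and>
     (4 / of_nat n :: rat) = 1 / of_nat n1 + 1 / of_nat n2 + 1 / of_nat n3"

text \<open>Wild solutions of the equation for \<open>24 * m + 1\<close>, where \<open>m\<close> is positive;
  \<open>L\<close> is the multiplier and \<open>J1\<close>, \<open>J2\<close> are the numerator summands.
  The subtraction in \<open>4 * k - 1\<close> does not truncate, since \<open>k \<ge> 1\<close>.\<close>

definition wild_solution :: "nat \<Rightarrow> nat \<Rightarrow> nat \<Rightarrow> nat \<Rightarrow> bool" where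
  "wild_solution m n1 n2 n3 \<longleftrightarrow>
     erdos_straus_solution (24 * m + 1) n1 n2 n3 \<and>
     (\<exists>k L J1 J2. 1 \<le> k \<and> k \<le> 12 * m \<and> n1 = 6 * m + k \<and>
        L \<ge> 2 \<and> J1 > 0 \<and> J2 > 0 \<and>
        J1 + J2 = L * (4 * k - 1) \<and> Gcd {L, J1, J2} = 1 \<and>
        (1 / of_nat n2 :: rat) = of_nat J1 / of_nat (L * (6 * m + k) * (24 * m + 1)) \<and>
        (1 / of_nat n3 :: rat) = of_nat J2 / of_nat (L * (6 * m + k) * (24 * m + 1)))"

end

theory Submission
  imports Defs
begin

text \<open>The hypothesis on \<open>m\<close> says exactly that \<open>6 * m + 1 = (6 * l - 1) * (6 * c + 5)\<close>.
  The solution is wild with \<open>k = 1\<close>, multiplier \<open>2 * l\<close>, and the splitting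
  \<open>2 * l * 3 = (6 * l - 1) + 1\<close> of the numerator.\<close>

theorem theorem3p1:
  fixes m l c :: nat
  assumes "m > 0" and "l > 0"
    and "m = 5 * l - 1 + c * (6 * l - 1)"
  shows "(4 / of_nat (24 * m + 1) :: rat) =
           1 / of_nat (6 * m + 1)
         + 1 / of_nat (2 * l * (6 * c + 5) * (24 * m + 1))
         + 1 / of_nat (2 * l * (6 * c + 5) * (6 * l - 1) * (24 * m + 1))
       \<and> wild_solution m
           (6 * m + 1)
           (2 * l * (6 * c + 5) * (24 * m + 1))
           (2 * l * (6 * c + 5) * (6 * l - 1) * (24 * m + 1))"
proof -
  define d where "d = 6 * l - 1"
  define q where "q = 6 * c + 5"
  define N where "N = 24 * m + 1"
  have d: "d + 1 = 6 * l" "d > 0" using \<open>l > 0\<close> by (simp_all add: d_def)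
  have "q > 0" "N > 0" by (simp_all add: q_def N_def)
  \<comment> \<open>Since \<open>l > 0\<close>, \<open>5 * l - 1\<close> does not truncate and
    \<open>6 * (5 * l - 1) + 1 = 30 * l - 5 = 5 * d\<close>; adding \<open>6 * c * d\<close> gives
    \<open>d * q\<close>.\<close>
  have "6 * m + 1 = 6 * (5 * l - 1) + 1 + 6 * c * d"
    by (simp add: assms(3) d_def algebra_simps)
  also have "6 * (5 * l - 1) + 1 = 5 * d" using \<open>l > 0\<close> by (simp add: d_def)
  finally have factor: "6 * m + 1 = d * q" by (simp add: q_def algebra_simps)
  have N: "N + 3 = 4 * (d * q)" using factor by (simp add: N_def)
  \<comment> \<open>Over the rationals the identity needs only positivity and the two relations
    \<open>D1\<close> and \<open>M3\<close>, both free of subtraction.\<close>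
  define D Q M L :: rat where "D = of_nat d" and "Q = of_nat q" and "M = of_nat N" and "L = of_nat l"
  have pos: "D > 0" "Q > 0" "M > 0" "L > 0"
    using d(2) \<open>q > 0\<close> \<open>N > 0\<close> \<open>l > 0\<close> by (simp_all add: D_def Q_def M_def L_def)
  have D1: "D + 1 = 6 * L"
    using arg_cong[OF d(1), of "of_nat :: nat \<Rightarrow> rat"] by (simp add: D_def L_def)
  have M3: "M + 3 = 4 * (D * Q)"
    using arg_cong[OF N, of "of_nat :: nat \<Rightarrow> rat"] by (simp add: D_def Q_def M_def)
  \<comment> \<open>The numerator \<open>D + 1 = 6 * L\<close> cancels the multiplier
    \<open>2 * L\<close> and leaves 3, exactly what \<open>M\<close> lacks to reach
    \<open>4 * (D * Q)\<close>.\<close>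
  have "1 / (2 * L * Q * M) + 1 / (2 * L * Q * D * M) = (D + 1) / (2 * L * Q * D * M)"
    using pos by (simp add: field_simps)
  also have "\<dots> = 3 / (D * Q * M)" unfolding D1 using pos by (simp add: field_simps)
  also have "1 / (D * Q) + \<dots> = (M + 3) / (D * Q * M)"
    using pos by (simp add: field_simps)
  also have "\<dots> = 4 / M" unfolding M3 using pos by (simp add: field_simps)
  finally have "4 / M = 1 / (D * Q) + 1 / (2 * L * Q * M) + 1 / (2 * L * Q * D * M)"
    by (simp add: add.assoc)
  then have eq: "(4 / of_nat N :: rat) = 1 / of_nat (d * q) + 1 / of_nat (2 * l * q * N)
      + 1 / of_nat (2 * l * q * d * N)"
    by (simp add: D_def Q_def M_def L_def)
  \<comment> \<open>The body of \<open>wild_solution\<close> at \<open>k = 1\<close>,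
    \<open>L = 2 * l\<close>, \<open>J1 = d\<close>, \<open>J2 = 1\<close>. The gcd is 1 because
    \<open>J2\<close> is 1; in the first fraction \<open>J1 = d\<close> cancels against the factor
    \<open>d\<close> of \<open>6 * m + 1\<close>.\<close>
  have "1 \<le> (1::nat) \<and> 1 \<le> 12 * m \<and> 6 * m + 1 = 6 * m + 1 \<and> 2 * l \<ge> 2 \<and> d > 0 \<and> (1::nat) > 0 \<and>
      d + 1 = 2 * l * (4 * 1 - 1) \<and> Gcd {2 * l, d, 1} = 1 \<and>
      (1 / of_nat (2 * l * q * N) :: rat) = of_nat d / of_nat (2 * l * (6 * m + 1) * N) \<and>
      (1 / of_nat (2 * l * q * d * N) :: rat) = of_nat 1 / of_nat (2 * l * (6 * m + 1) * N)"
    unfolding factor using d(1) \<open>m > 0\<close> \<open>l > 0\<close> by (simp add: d(2) field_simps)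
  moreover have "erdos_straus_solution N (6 * m + 1) (2 * l * q * N) (2 * l * q * d * N)"
    unfolding erdos_straus_solution_def factor
    using eq d(2) \<open>q > 0\<close> \<open>N > 0\<close> \<open>l > 0\<close> by simp
  ultimately have "wild_solution m (6 * m + 1) (2 * l * q * N) (2 * l * q * d * N)"
    unfolding wild_solution_def N_def by blast
  with eq[folded factor] show ?thesis unfolding d_def q_def N_def by blast
qed

end
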